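(* For every $n\ge 1$ the inclusions of sets of games $$\mathcal{W}_n^+ \subseteq \Pi_n \subseteq J_n^+$$ hold. The first inclusion is strict if and only if $n\ge 7$, and the second inclusion is strict if and only if $n\ge 6$.
   Context: Let $N=\{1,\dots,n\}$. A simple game on $N$ is a family $W$ of subsets of $N$ (the winning coalitions) with $N\in W$, $\emptyset\notin W$, and such that $S\in W$, $S\subseteq R\subseteq N$ imply $R\in W$. Partially order the subsets of $N$ (poset $M(n)$) as follows: writing $A=\{a_1>a_2>\dots>a_k\}$ and $B=\{b_1>\dots>b_j\}$, set $B\ge A$ iff $k\le j$ and $b_i\ge a_i$ for all $i\le k$. A linear game on $n$ voters is a simple game $v$ whose set of winning coalitions $W_v$ is an up-set of $M(n)$. $J_n$ is the set of all linear games on $n$ voters; the rank of $v\in J_n$ is the number of losing coalitions (subsets of $N$ not in $W_v$), and $J_n^+$ is the set of linear games of rank at least $2^{n-1}$. A game is proper if for no coalition $A$ are both $A$ and $N\setminus A$ winning; $\Pi_n$ is the set of proper linear games on $n$ voters. A linear game $v$ is weighted if there are weights $w_n\ge w_{n-1}\ge\dots\ge w_1\ge 0$ and a quota $q\in(0,\sum_i w_i]$ such that $A\in W_v$ iff $\sum_{i\in A}w_i\ge q$. $\mathcal{W}_n^+$ denotes the set of weighted games on $n$ voters of rank at least $2^{n-1}$. *)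

theory Defs
  imports Complex_Main
begin

definition players :: "nat \<Rightarrow> nat set" where
  "players n = {1..n}"

text \<open>A game is represented by its family of winning coalitions.\<close>

definition simple_game :: "nat \<Rightarrow> nat set set \<Rightarrow> bool" where
  "simple_game n W \<longleftrightarrow>
     W \<subseteq> Pow (players n) \<and> players n \<in> W \<and> {} \<notin> W \<and>
     (\<forall>S R. S \<in> W \<and> S \<subseteq> R \<and> R \<subseteq> players n \<longrightarrow> R \<in> W)"

text \<open>\<open>desc A\<close> lists a finite set \<open>A = {a\<^sub>1 > a\<^sub>2 > \<dots>}\<close> in decreasing order; list positions
  start at \<open>0\<close>, so \<open>a\<^sub>i\<close> is \<open>desc A ! (i - 1)\<close>.\<close>

definition desc :: "nat set \<Rightarrow> nat list" where
  "desc A = rev (sorted_list_of_set A)"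

text \<open>The order of the poset \<open>M(n)\<close>. The formula does not mention \<open>n\<close>; it is only used for
  subsets of \<^term>\<open>players n\<close>.\<close>

definition M_le :: "nat set \<Rightarrow> nat set \<Rightarrow> bool" where
  "M_le A B \<longleftrightarrow>
     length (desc A) \<le> length (desc B) \<and>
     (\<forall>i < length (desc A). desc A ! i \<le> desc B ! i)"

definition M_up_set :: "nat \<Rightarrow> nat set set \<Rightarrow> bool" where
  "M_up_set n W \<longleftrightarrow>
     W \<subseteq> Pow (players n) \<and>
     (\<forall>A B. A \<in> W \<and> B \<subseteq> players n \<and> M_le A B \<longrightarrow> B \<in> W)"

definition linear_games :: "nat \<Rightarrow> nat set set set" where
  "linear_games n = {W. simple_game n W \<and> M_up_set n W}"

definition game_rank :: "nat \<Rightarrow> nat set set \<Rightarrow> nat" where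
  "game_rank n W = card {A. A \<subseteq> players n \<and> A \<notin> W}"

definition linear_games_plus :: "nat \<Rightarrow> nat set set set" where
  "linear_games_plus n = {W \<in> linear_games n. game_rank n W \<ge> 2 ^ (n - 1)}"

definition proper_game :: "nat \<Rightarrow> nat set set \<Rightarrow> bool" where
  "proper_game n W \<longleftrightarrow> \<not> (\<exists>A \<subseteq> players n. A \<in> W \<and> players n - A \<in> W)"

definition proper_linear_games :: "nat \<Rightarrow> nat set set set" where
  "proper_linear_games n = {W \<in> linear_games n. proper_game n W}"

definition weighted_games :: "nat \<Rightarrow> nat set set set" where
  "weighted_games n =
     {W \<in> linear_games n. \<exists>(w :: nat \<Rightarrow> real) (q :: real).
        (\<forall>i \<in> players n. 0 \<le> w i) \<and>
        (\<forall>i \<in> players n. \<forall>j \<in> players n. i \<le> j \<longrightarrow> w i \<le> w j) \<and>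
        0 < q \<and> q \<le> (\<Sum>i \<in> players n. w i) \<and>
        (\<forall>A \<subseteq> players n. A \<in> W \<longleftrightarrow> q \<le> (\<Sum>i \<in> A. w i))}"

definition weighted_games_plus :: "nat \<Rightarrow> nat set set set" where
  "weighted_games_plus n = {W \<in> weighted_games n. game_rank n W \<ge> 2 ^ (n - 1)}"

end

theory Submission
  imports Defs
begin

text \<open>Complementation exchanges winning and losing coalitions up to the pairs \<open>A\<close>, \<open>N - A\<close> that are both
  winning or both losing, and the weights of a weighted game exclude that pairs of both kinds
  occur; counting gives the two inclusions. Adding a dummy player preserves being a linear game,
  being proper, not being weighted, and having rank at least \<open>2 ^ (n - 1)\<close>, so it suffices to separate
  the classes at \<open>n = 7\<close> and \<open>n = 6\<close>, and to identify them at \<open>n = 6\<close> and \<open>n = 5\<close>. The separating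
  games are generated by two coalitions each. For the identifications, coalitions are represented by
  decreasing lists, on which the order of \<open>M(n)\<close> is computable: at \<open>n = 5\<close>, a coalition and its
  complement together lie below more than half of all coalitions; at \<open>n = 6\<close>, a search over all
  566 proper linear games finds weights for each of them.\<close>

section \<open>The order of M(n) on decreasing lists\<close>

fun list_le :: "nat list \<Rightarrow> nat list \<Rightarrow> bool" where
  "list_le [] bs = True"
| "list_le (a # as) [] = False"
| "list_le (a # as) (b # bs) = (a \<le> b \<and> list_le as bs)"

lemma list_le_iff:
  "list_le as bs \<longleftrightarrow> length as \<le> length bs \<and> (\<forall>i < length as. as ! i \<le> bs ! i)"
  by (induction as bs rule: list_le.induct) (auto simp: less_Suc_eq_0_disj)

lemma M_le_iff: "M_le A B \<longleftrightarrow> list_le (desc A) (desc B)"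
  by (simp add: M_le_def list_le_iff)

lemma list_le_trans: "list_le as bs \<Longrightarrow> list_le bs cs \<Longrightarrow> list_le as cs"
  unfolding list_le_iff by (meson less_le_trans order_trans)

lemma list_le_refl [simp]: "list_le as as"
  by (simp add: list_le_iff)

text \<open>Prefixing shifts the entries of \<open>bs\<close> one place to the right, and in a
  decreasing list this puts a larger entry at every position.\<close>

lemma list_le_Cons:
  "list_le as bs \<Longrightarrow> sorted_wrt (>) (b # bs) \<Longrightarrow> list_le as (b # bs)"
proof (induction as bs arbitrary: b rule: list_le.induct)
  case (3 a as c bs)
  then have "list_le as (c # bs)" by simp
  with 3 show ?case by auto
qed auto

lemma list_le_subset:
  "sorted_wrt (>) as \<Longrightarrow> sorted_wrt (>) bs \<Longrightarrow> set as \<subseteq> set bs \<Longrightarrow> list_le as bs"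
proof (induction bs arbitrary: as)
  case (Cons b bs)
  show ?case
  proof (cases as)
    case as: (Cons a as')
    show ?thesis
    proof (cases "a = b")
      case True
      then have "set as' \<subseteq> set bs"
        using Cons.prems as by auto
      then show ?thesis
        using Cons as True by simp
    next
      case False
      then have "set as \<subseteq> set bs"
        using Cons.prems as by fastforce
      then show ?thesis
        using Cons by (simp add: list_le_Cons)
    qed
  qed simp
qed simp

section \<open>Coalitions as decreasing lists\<close>

lemma finite_players [simp]: "finite (players n)"
  by (simp add: players_def)

lemma finite_subset_players: "A \<subseteq> players n \<Longrightarrow> finite A"
  using finite_players finite_subset by blast

lemma set_desc: "finite A \<Longrightarrow> set (desc A) = A"
  by (simp add: desc_def)

lemma sorted_desc: "sorted_wrt (>) (desc A)"
  by (simp add: desc_def sorted_wrt_rev)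

lemma distinct_desc: "distinct (desc A)"
  by (simp add: desc_def)

lemma desc_set: "sorted_wrt (>) as \<Longrightarrow> desc (set as) = as"
proof -
  assume "sorted_wrt (>) as"
  then have "sorted_wrt (<) (rev as)"
    by (simp add: sorted_wrt_rev)
  then have "sorted_list_of_set (set (rev as)) = rev as"
    by (intro sorted_list_of_set.idem_if_sorted_distinct) (auto simp: strict_sorted_iff)
  then show ?thesis
    by (simp add: desc_def)
qed

lemma desc_eqI: "sorted_wrt (>) as \<Longrightarrow> set as = A \<Longrightarrow> desc A = as"
  using desc_set by blast

lemma M_le_subset: "A \<subseteq> B \<Longrightarrow> finite B \<Longrightarrow> M_le A B"
  unfolding M_le_iff
  by (intro list_le_subset) (auto simp: sorted_desc set_desc finite_subset)

text \<open>The order of the enumeration matters later: the grand coalition comes first, so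
  \<open>tl\<close> removes exactly it.\<close>

fun coalitions :: "nat \<Rightarrow> nat list list" where
  "coalitions 0 = [[]]"
| "coalitions (Suc n) = map ((#) (Suc n)) (coalitions n) @ coalitions n"

lemma coalitions_iff:
  "as \<in> set (coalitions n) \<longleftrightarrow> sorted_wrt (>) as \<and> set as \<subseteq> players n"
proof (induction n arbitrary: as)
  case 0
  then show ?case by (auto simp: players_def)
next
  case (Suc n)
  have *: "players (Suc n) = insert (Suc n) (players n)" "Suc n \<notin> players n"
      "\<And>i. i \<in> players n \<Longrightarrow> i < Suc n"
    by (auto simp: players_def)
  show ?case
  proof (cases as)
    case Nil
    then show ?thesis by (auto simp: Suc)
  next
    case (Cons a as')
    show ?thesis
    proof (cases "a = Suc n")
      case True
      have "sorted_wrt (>) (Suc n # as') \<and> set as' \<subseteq> insert (Suc n) (players n)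
          \<longleftrightarrow> sorted_wrt (>) as' \<and> set as' \<subseteq> players n"
        using * by force
      then show ?thesis
        using Cons True * by (auto simp: Suc)
    next
      case False
      then have "sorted_wrt (>) as \<and> set as \<subseteq> insert (Suc n) (players n)
          \<longleftrightarrow> sorted_wrt (>) as \<and> set as \<subseteq> players n"
        using Cons * by fastforce
      then show ?thesis
        using Cons False * by (auto simp: Suc)
    qed
  qed
qed

lemma desc_in_coalitions: "A \<subseteq> players n \<Longrightarrow> desc A \<in> set (coalitions n)"
  by (simp add: coalitions_iff sorted_desc set_desc finite_subset_players)

lemma distinct_coalitions: "distinct (coalitions n)"
proof (induction n)
  case (Suc n)
  have "set (map ((#) (Suc n)) (coalitions n)) \<inter> set (coalitions n) = {}"
    by (auto simp: coalitions_iff players_def)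
  then show ?case
    using Suc by (simp add: distinct_map)
qed simp

text \<open>Turns counting coalitions into evaluating a list length; \<open>set\<close> is the
  bijection and \<open>desc\<close> its inverse.\<close>

lemma card_desc_filter:
  "card {A. A \<subseteq> players n \<and> P (desc A)} = length (filter P (coalitions n))"
proof -
  have "set ` set (filter P (coalitions n)) = {A. A \<subseteq> players n \<and> P (desc A)}" (is "?L = ?R")
  proof
    show "?L \<subseteq> ?R"
      by (auto simp: coalitions_iff desc_set)
    show "?R \<subseteq> ?L"
    proof
      fix A assume "A \<in> ?R"
      then have "desc A \<in> set (filter P (coalitions n))" "A = set (desc A)"
        by (auto simp: desc_in_coalitions set_desc finite_subset_players)
      then show "A \<in> ?L" by blast
    qed
  qed
  moreover have "inj_on set (set (filter P (coalitions n)))"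
    by (rule inj_on_inverseI[of _ desc]) (simp add: coalitions_iff desc_set)
  ultimately have "card {A. A \<subseteq> players n \<and> P (desc A)} = card (set (filter P (coalitions n)))"
    using card_image by metis
  then show ?thesis
    by (simp only: distinct_card distinct_filter distinct_coalitions)
qed

text \<open>Filtering the reversed interval keeps the result decreasing. In particular
  \<open>compl n []\<close> is the grand coalition and is used under that form.\<close>

definition compl :: "nat \<Rightarrow> nat list \<Rightarrow> nat list" where
  "compl n as = filter (\<lambda>i. i \<notin> set as) (rev [1..<Suc n])"

lemma compl_desc: "A \<subseteq> players n \<Longrightarrow> desc (players n - A) = compl n (desc A)"
  by (rule desc_eqI)
    (auto simp: compl_def sorted_wrt_rev set_desc finite_subset_players players_def
      simp del: upt_Suc intro!: sorted_wrt_filter)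

lemma compl_in_coalitions: "compl n as \<in> set (coalitions n)"
  by (auto simp: coalitions_iff compl_def sorted_wrt_rev players_def
      simp del: upt_Suc intro!: sorted_wrt_filter)

section \<open>Linear games, ranks and the two inclusions\<close>

lemma linear_games_iff:
  "W \<in> linear_games n \<longleftrightarrow> W \<subseteq> Pow (players n) \<and> players n \<in> W \<and> {} \<notin> W \<and>
     (\<forall>A B. A \<in> W \<longrightarrow> B \<subseteq> players n \<longrightarrow> M_le A B \<longrightarrow> B \<in> W)"
proof -
  let ?up = "\<forall>A B. A \<in> W \<and> B \<subseteq> players n \<and> M_le A B \<longrightarrow> B \<in> W"
  let ?up' = "\<forall>A B. A \<in> W \<longrightarrow> B \<subseteq> players n \<longrightarrow> M_le A B \<longrightarrow> B \<in> W"
  let ?sup = "\<forall>S R. S \<in> W \<and> S \<subseteq> R \<and> R \<subseteq> players n \<longrightarrow> R \<in> W"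
  have eq: "?up \<longleftrightarrow> ?up'"
    by (simp only: imp_conjL)
  \<comment> \<open>The order of M(n) extends inclusion.\<close>
  have "?up' \<longrightarrow> ?sup"
    using M_le_subset finite_subset_players by metis
  then show ?thesis
    unfolding linear_games_def simple_game_def M_up_set_def mem_Collect_eq eq by argo
qed

lemma linear_gamesD:
  assumes "W \<in> linear_games n"
  shows "W \<subseteq> Pow (players n)" "players n \<in> W" "{} \<notin> W"
    and "A \<in> W \<Longrightarrow> B \<subseteq> players n \<Longrightarrow> M_le A B \<Longrightarrow> B \<in> W"
  using assms by (auto simp only: linear_games_iff Pow_iff)

lemma card_winning_plus_rank:
  assumes "W \<in> linear_games n"
  shows "card W + game_rank n W = 2 ^ n"
proof -
  have W: "W \<subseteq> Pow (players n)"
    using assms by (rule linear_gamesD)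
  have "{A. A \<subseteq> players n \<and> A \<notin> W} = Pow (players n) - W"
    by auto
  then have "card W + game_rank n W = card (Pow (players n))"
    unfolding game_rank_def using W
    by (metis card_Diff_subset card_mono finite_Pow_iff finite_players finite_subset le_add_diff_inverse)
  then show ?thesis
    by (simp add: card_Pow players_def)
qed

lemma inj_on_compl_players: "inj_on (\<lambda>A. players n - A) (Pow (players n))"
  by (auto intro!: inj_onI)

lemma two_times_half: "n \<ge> 1 \<Longrightarrow> 2 * 2 ^ (n - 1) = (2 :: nat) ^ n"
  by (cases n) auto

lemma weighted_plus_subset_proper:
  assumes "n \<ge> 1"
  shows "weighted_games_plus n \<subseteq> proper_linear_games n"
proof
  fix W assume W: "W \<in> weighted_games_plus n"
  then have lin: "W \<in> linear_games n" and rank: "game_rank n W \<ge> 2 ^ (n - 1)"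
    by (auto simp: weighted_games_plus_def weighted_games_def)
  obtain w :: "nat \<Rightarrow> real" and q
    where win: "\<And>A. A \<subseteq> players n \<Longrightarrow> A \<in> W \<longleftrightarrow> q \<le> sum w A"
    using W by (auto simp: weighted_games_plus_def weighted_games_def)
  have compl_sum: "sum w (players n - A) = sum w (players n) - sum w A" if "A \<subseteq> players n" for A
    using that by (simp add: sum_diff)
  have False if A: "A \<subseteq> players n" "A \<in> W" "players n - A \<in> W" for A
  proof -
    let ?L = "{A. A \<subseteq> players n \<and> A \<notin> W}"
    \<comment> \<open>Two complementary winning coalitions force the total weight to be at least
      \<open>2 * q\<close>, so the complement of a losing coalition weighs more than
      \<open>q\<close>.\<close>
    have "2 * q \<le> sum w (players n)"
      using A win[of A] win[of "players n - A"] compl_sum by auto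
    then have "players n - S \<in> W" if "S \<in> ?L" for S
      using that win[of S] win[of "players n - S"] compl_sum by auto
    \<comment> \<open>\<open>A\<close> is missed by complementation of losing coalitions, because
      its own complement wins. This makes the count strict: fewer than half of all coalitions
      lose.\<close>
    moreover have "players n - S \<noteq> A" if "S \<in> ?L" for S
      using that A by (metis (no_types, lifting) double_diff mem_Collect_eq subset_refl)
    ultimately have "(\<lambda>A. players n - A) ` ?L \<subseteq> W - {A}"
      by auto
    moreover have finW: "finite W"
      using linear_gamesD(1)[OF lin] finite_subset by fastforce
    moreover have "inj_on (\<lambda>A. players n - A) ?L"
      by (rule inj_on_subset[OF inj_on_compl_players]) auto
    ultimately have "game_rank n W \<le> card (W - {A})"
      unfolding game_rank_def using card_inj_on_le by (metis (no_types, lifting) finite_Diff)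
    also have "\<dots> < card W"
      using finW A by (intro card_Diff1_less)
    finally show False
      using card_winning_plus_rank[OF lin] rank two_times_half[OF assms] by linarith
  qed
  then show "W \<in> proper_linear_games n"
    using lin by (auto simp: proper_linear_games_def proper_game_def)
qed

text \<open>In a proper game complementation maps winning coalitions injectively to losing ones, so
  at least half of all coalitions lose.\<close>

lemma proper_subset_plus:
  assumes "n \<ge> 1"
  shows "proper_linear_games n \<subseteq> linear_games_plus n"
proof
  fix W assume "W \<in> proper_linear_games n"
  then have lin: "W \<in> linear_games n" and proper: "proper_game n W"
    by (auto simp: proper_linear_games_def)
  have "(\<lambda>A. players n - A) ` W \<subseteq> {A. A \<subseteq> players n \<and> A \<notin> W}"
    using proper linear_gamesD(1)[OF lin] by (auto simp: proper_game_def)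
  moreover have "inj_on (\<lambda>A. players n - A) W"
    by (rule inj_on_subset[OF inj_on_compl_players]) (rule linear_gamesD(1)[OF lin])
  ultimately have "card W \<le> game_rank n W"
    unfolding game_rank_def by (intro card_inj_on_le) auto
  then show "W \<in> linear_games_plus n"
    using card_winning_plus_rank[OF lin] lin two_times_half[OF assms]
    by (simp add: linear_games_plus_def)
qed

subsection \<open>Adding a dummy player\<close>

text \<open>Inverse to the renumbering by \<open>Suc\<close>, forgetting the dummy: the bound
  \<open>1 \<le> i\<close> keeps player 1 from turning into 0.\<close>

definition tail :: "nat set \<Rightarrow> nat set" where
  "tail A = {i. 1 \<le> i \<and> Suc i \<in> A}"

text \<open>The new player is the weakest one, so the old players are renumbered by \<^const>\<open>Suc\<close>.\<close>

definition add_dummy :: "nat \<Rightarrow> nat set set \<Rightarrow> nat set set" where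
  "add_dummy n W = {A. A \<subseteq> players (Suc n) \<and> tail A \<in> W}"

lemma tail_compl: "tail (players (Suc n) - A) = players n - tail A"
  by (auto simp: tail_def players_def)

lemma tail_image_Suc:
  assumes "A \<subseteq> players n"
  shows "tail (Suc ` A) = A" "tail (insert 1 (Suc ` A)) = A"
  using assms by (auto simp: tail_def players_def)

lemma image_Suc_players: "A \<subseteq> players n \<Longrightarrow> Suc ` A \<subseteq> players (Suc n)"
  by (auto simp: players_def)

lemma image_Suc_in_add_dummy:
  "A \<subseteq> players n \<Longrightarrow> Suc ` A \<in> add_dummy n W \<longleftrightarrow> A \<in> W"
  by (simp add: add_dummy_def tail_image_Suc image_Suc_players)

lemma desc_tail:
  assumes "finite A"
  shows "desc (tail A) = map (\<lambda>i. i - 1) (filter (\<lambda>i. 2 \<le> i) (desc A))"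
proof (rule desc_eqI)
  have "sorted_wrt (>) (filter (\<lambda>i. 2 \<le> i) (desc A))"
    by (simp add: sorted_wrt_filter sorted_desc)
  then show "sorted_wrt (>) (map (\<lambda>i. i - 1) (filter (\<lambda>i. 2 \<le> i) (desc A)))"
    unfolding sorted_wrt_map by (rule sorted_wrt_mono_rel[rotated]) auto
  show "set (map (\<lambda>i. i - 1) (filter (\<lambda>i. 2 \<le> i) (desc A))) = tail A"
    using assms by (force simp: set_desc tail_def image_iff)
qed

text \<open>If the head of \<open>as\<close> is at least 2, so is the head of \<open>bs\<close>, and
  the surviving heads still match. Otherwise the decreasing list \<open>as\<close> is filtered away
  entirely.\<close>

lemma list_le_tail:
  "list_le as bs \<Longrightarrow> sorted_wrt (>) as \<Longrightarrow>
   list_le (map (\<lambda>i. i - 1) (filter (\<lambda>i. 2 \<le> i) as)) (map (\<lambda>i. i - 1) (filter (\<lambda>i. 2 \<le> i) bs))"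
proof (induction as bs rule: list_le.induct)
  case (3 a as b bs)
  show ?case
  proof (cases "2 \<le> a")
    case True
    then show ?thesis using 3 by auto
  next
    case False
    then have "filter (\<lambda>i. 2 \<le> i) (a # as) = []"
      using 3 by (fastforce simp: filter_empty_conv)
    then show ?thesis by simp
  qed
qed auto

lemma M_le_tail: "M_le A B \<Longrightarrow> finite A \<Longrightarrow> finite B \<Longrightarrow> M_le (tail A) (tail B)"
  by (simp only: M_le_iff desc_tail list_le_tail sorted_desc)

lemma add_dummy_linear:
  assumes "W \<in> linear_games n"
  shows "add_dummy n W \<in> linear_games (Suc n)"
proof -
  have "tail (players (Suc n)) = players n" "tail {} = {}"
    by (auto simp: tail_def players_def)
  moreover have "tail B \<in> W"
    if "A \<subseteq> players (Suc n)" "tail A \<in> W" "B \<subseteq> players (Suc n)" "M_le A B" for A B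
  proof (rule linear_gamesD(4)[OF assms])
    show "tail B \<subseteq> players n"
      using that by (auto simp: tail_def players_def)
    show "M_le (tail A) (tail B)"
      using that finite_subset_players by (blast intro: M_le_tail)
  qed (use that in auto)
  moreover have "players n \<in> W" "{} \<notin> W"
    using assms by (rule linear_gamesD)+
  ultimately show ?thesis
    unfolding linear_games_iff add_dummy_def by auto
qed

lemma add_dummy_proper_iff: "proper_game (Suc n) (add_dummy n W) \<longleftrightarrow> proper_game n W"
proof
  assume proper: "proper_game n W"
  have False if "A \<subseteq> players (Suc n)" "A \<in> add_dummy n W" "players (Suc n) - A \<in> add_dummy n W" for A
  proof -
    have "tail A \<subseteq> players n"
      using that by (auto simp: tail_def players_def)
    then show False
      using that proper by (auto simp: add_dummy_def proper_game_def tail_compl)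
  qed
  then show "proper_game (Suc n) (add_dummy n W)"
    by (auto simp: proper_game_def)
next
  assume proper: "proper_game (Suc n) (add_dummy n W)"
  have False if "A \<subseteq> players n" "A \<in> W" "players n - A \<in> W" for A
  proof -
    have "tail (players (Suc n) - Suc ` A) = players n - A"
      using that by (simp add: tail_compl tail_image_Suc)
    then have "players (Suc n) - Suc ` A \<in> add_dummy n W"
      using that by (simp add: add_dummy_def)
    moreover have "Suc ` A \<in> add_dummy n W"
      using that by (simp add: image_Suc_in_add_dummy)
    ultimately show False
      using proper image_Suc_players[OF that(1)] unfolding proper_game_def by metis
  qed
  then show "proper_game n W"
    by (auto simp: proper_game_def)
qed

text \<open>Every losing coalition lifts to two losing ones, without and with the dummy player
  1.\<close>

lemma add_dummy_rank: "2 * game_rank n W \<le> game_rank (Suc n) (add_dummy n W)"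
proof -
  let ?L = "{A. A \<subseteq> players n \<and> A \<notin> W}"
  let ?L' = "{A. A \<subseteq> players (Suc n) \<and> A \<notin> add_dummy n W}"
  let ?f = "\<lambda>A. Suc ` A" and ?g = "\<lambda>A. insert 1 (Suc ` A)"
  have fin: "finite ?L" "finite ?L'"
    by simp_all
  have sub: "?f ` ?L \<union> ?g ` ?L \<subseteq> ?L'"
  proof -
    have "Suc ` A \<in> ?L'" "insert 1 (Suc ` A) \<in> ?L'" if "A \<in> ?L" for A
      using that tail_image_Suc[of A n] image_Suc_players[of A n]
      by (auto simp: add_dummy_def players_def)
    then show ?thesis by blast
  qed
  have inj: "inj_on ?f ?L" "inj_on ?g ?L"
    using tail_image_Suc[of _ n] by (auto intro!: inj_on_inverseI[of _ tail])
  have disj: "?f ` ?L \<inter> ?g ` ?L = {}"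
  proof -
    have "1 \<notin> Suc ` A" if "A \<in> ?L" for A
      using that by (auto simp: players_def)
    then show ?thesis by blast
  qed
  have "2 * card ?L = card (?f ` ?L) + card (?g ` ?L)"
    using inj by (simp add: card_image)
  also have "\<dots> = card (?f ` ?L \<union> ?g ` ?L)"
    using disj fin by (simp add: card_Un_disjoint)
  also have "\<dots> \<le> card ?L'"
    using fin(2) sub by (rule card_mono)
  finally show ?thesis
    by (simp add: game_rank_def)
qed

lemma weighted_of_add_dummy:
  assumes W: "W \<in> linear_games n" and "add_dummy n W \<in> weighted_games (Suc n)"
  shows "W \<in> weighted_games n"
proof -
  obtain w :: "nat \<Rightarrow> real" and q where
      nonneg: "\<forall>i \<in> players (Suc n). 0 \<le> w i"
    and mono: "\<forall>i \<in> players (Suc n). \<forall>j \<in> players (Suc n). i \<le> j \<longrightarrow> w i \<le> w j"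
    and "0 < q"
    and win: "\<forall>A \<subseteq> players (Suc n). A \<in> add_dummy n W \<longleftrightarrow> q \<le> sum w A"
  proof -
    have "\<exists>(w :: nat \<Rightarrow> real) q. (\<forall>i \<in> players (Suc n). 0 \<le> w i) \<and>
        (\<forall>i \<in> players (Suc n). \<forall>j \<in> players (Suc n). i \<le> j \<longrightarrow> w i \<le> w j) \<and>
        0 < q \<and> q \<le> sum w (players (Suc n)) \<and>
        (\<forall>A \<subseteq> players (Suc n). A \<in> add_dummy n W \<longleftrightarrow> q \<le> sum w A)"
      using assms(2) by (simp add: weighted_games_def)
    then show ?thesis
      using that by (elim exE conjE)
  qed
  have win': "A \<in> W \<longleftrightarrow> q \<le> (\<Sum>i\<in>A. w (Suc i))" if "A \<subseteq> players n" for A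
  proof -
    have "A \<in> W \<longleftrightarrow> q \<le> sum w (Suc ` A)"
      using win[rule_format, OF image_Suc_players[OF that]] image_Suc_in_add_dummy[OF that] by simp
    then show ?thesis
      by (simp add: sum.reindex)
  qed
  have Suc_players: "Suc i \<in> players (Suc n)" if "i \<in> players n" for i
    using that by (auto simp: players_def)
  then show ?thesis
    unfolding weighted_games_def
  proof (intro CollectI conjI exI[of _ "\<lambda>i. w (Suc i)"] exI[of _ q])
    \<comment> \<open>Dropping the dummy may lower the total weight, so the bound on the quota comes
      from the grand coalition winning.\<close>
    show "q \<le> (\<Sum>i\<in>players n. w (Suc i))"
      using win' linear_gamesD(2)[OF W] by blast
    show "\<forall>A \<subseteq> players n. A \<in> W \<longleftrightarrow> q \<le> (\<Sum>i\<in>A. w (Suc i))"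
      using win' by blast
    show "W \<in> linear_games n" "0 < q"
      by fact+
    show "\<forall>i \<in> players n. 0 \<le> w (Suc i)"
      using nonneg Suc_players by blast
    show "\<forall>i \<in> players n. \<forall>j \<in> players n. i \<le> j \<longrightarrow> w (Suc i) \<le> w (Suc j)"
      using mono Suc_players by (meson Suc_le_mono)
  qed
qed

text \<open>Read contrapositively, strictness at \<open>n\<close> passes to \<open>Suc n\<close>:
  the dummy extension of a proper game that is not weighted is again such a game.\<close>

lemma weighted_plus_eq_proper_down:
  assumes "n \<ge> 1" and "weighted_games_plus (Suc n) = proper_linear_games (Suc n)"
  shows "weighted_games_plus n = proper_linear_games n"
proof
  show "weighted_games_plus n \<subseteq> proper_linear_games n"
    using assms(1) by (rule weighted_plus_subset_proper)
  show "proper_linear_games n \<subseteq> weighted_games_plus n"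
  proof
    fix W assume W: "W \<in> proper_linear_games n"
    then have "add_dummy n W \<in> weighted_games_plus (Suc n)"
      using assms(2) by (auto simp: proper_linear_games_def add_dummy_linear add_dummy_proper_iff)
    moreover have "W \<in> linear_games_plus n"
      using W proper_subset_plus[OF assms(1)] by blast
    ultimately show "W \<in> weighted_games_plus n"
      by (auto simp: weighted_games_plus_def linear_games_plus_def intro: weighted_of_add_dummy)
  qed
qed

text \<open>The doubling in \<open>add_dummy_rank\<close> matches the doubling of the rank bound, so
  an improper game of large rank extends to one with a further player.\<close>

lemma proper_eq_plus_down:
  assumes "n \<ge> 1" and "proper_linear_games (Suc n) = linear_games_plus (Suc n)"
  shows "proper_linear_games n = linear_games_plus n"
proof
  show "proper_linear_games n \<subseteq> linear_games_plus n"
    using assms(1) by (rule proper_subset_plus)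
  show "linear_games_plus n \<subseteq> proper_linear_games n"
  proof
    fix W assume W: "W \<in> linear_games_plus n"
    then have "2 ^ n \<le> game_rank (Suc n) (add_dummy n W)"
      using add_dummy_rank[of n W] two_times_half[OF assms(1)]
      by (auto simp: linear_games_plus_def)
    then have "add_dummy n W \<in> proper_linear_games (Suc n)"
      using W assms(2) by (auto simp: linear_games_plus_def add_dummy_linear)
    then show "W \<in> proper_linear_games n"
      using W by (auto simp: proper_linear_games_def linear_games_plus_def add_dummy_proper_iff)
  qed
qed

subsection \<open>Counterexamples\<close>

definition generated_game :: "nat \<Rightarrow> nat list list \<Rightarrow> nat set set" where
  "generated_game n G = {A. A \<subseteq> players n \<and> list_ex (\<lambda>g. list_le g (desc A)) G}"

lemma generated_game_linear:
  assumes "[] \<notin> set G" and "list_ex (\<lambda>g. list_le g (compl n [])) G"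
  shows "generated_game n G \<in> linear_games n"
proof -
  have "desc (players n) = compl n []"
    using compl_desc[of "{}" n] by (simp add: desc_def)
  moreover have "\<not> list_le g (desc {})" if "g \<in> set G" for g
    using that assms(1) by (metis desc_def list.exhaust list_le.simps(2) rev.simps(1)
        sorted_list_of_set.sorted_key_list_of_set_empty)
  ultimately show ?thesis
    using assms(2)
    by (auto simp: linear_games_iff generated_game_def list_ex_iff M_le_iff intro: list_le_trans)
qed

text \<open>The two generators are complementary, which makes the game improper, yet at least 32 of
  the 64 coalitions lie above neither of them.\<close>

lemma proper_ne_plus_6: "proper_linear_games 6 \<noteq> linear_games_plus 6"
proof -
  let ?G = "[[6, 5], [4, 3, 2, 1]]"
  let ?W = "generated_game 6 ?G"
  have "list_ex (\<lambda>g. list_le g (compl 6 [])) ?G"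
    by code_simp
  then have lin: "?W \<in> linear_games 6"
    by (intro generated_game_linear) auto
  have "{A. A \<subseteq> players 6 \<and> A \<notin> ?W}
      = {A. A \<subseteq> players 6 \<and> \<not> list_ex (\<lambda>g. list_le g (desc A)) ?G}"
    by (auto simp: generated_game_def)
  then have "game_rank 6 ?W
      = length (filter (\<lambda>as. \<not> list_ex (\<lambda>g. list_le g as) ?G) (coalitions 6))"
    unfolding game_rank_def
    using card_desc_filter[of 6 "\<lambda>as. \<not> list_ex (\<lambda>g. list_le g as) ?G"] by (simp only:)
  moreover have "32 \<le> length (filter (\<lambda>as. \<not> list_ex (\<lambda>g. list_le g as) ?G) (coalitions 6))"
    by code_simp
  ultimately have "?W \<in> linear_games_plus 6"
    using lin by (simp add: linear_games_plus_def)
  moreover have "?W \<notin> proper_linear_games 6"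
  proof -
    have "desc {6, 5} = [6, 5]" "desc {4, 3, 2, 1} = [4, 3, 2, 1]"
      by (rule desc_eqI; auto)+
    moreover have "players 6 - {6, 5} = {4, 3, 2, 1}" "{6, 5} \<subseteq> players 6" "{4, 3, 2, 1} \<subseteq> players 6"
      by (auto simp: players_def)
    ultimately have "{6, 5} \<subseteq> players 6 \<and> {6, 5} \<in> ?W \<and> players 6 - {6, 5} \<in> ?W"
      by (simp add: generated_game_def)
    then show ?thesis
      unfolding proper_linear_games_def proper_game_def by blast
  qed
  ultimately show ?thesis by blast
qed

text \<open>The two generators can trade players so as to become the losing coalitions
  \<open>{7, 6, 4, 3}\<close> and \<open>{7, 5, 2, 1}\<close>, which rules out weights.\<close>

lemma weighted_plus_ne_proper_7: "weighted_games_plus 7 \<noteq> proper_linear_games 7"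
proof -
  let ?G = "[[7, 6, 5], [7, 4, 3, 2, 1]]"
  let ?W = "generated_game 7 ?G"
  have "list_ex (\<lambda>g. list_le g (compl 7 [])) ?G"
    by code_simp
  then have lin: "?W \<in> linear_games 7"
    by (intro generated_game_linear) auto
  have "list_all (\<lambda>as. \<not> (list_ex (\<lambda>g. list_le g as) ?G \<and> list_ex (\<lambda>g. list_le g (compl 7 as)) ?G))
      (coalitions 7)"
    by code_simp
  then have "\<not> (A \<in> ?W \<and> players 7 - A \<in> ?W)" if "A \<subseteq> players 7" for A
    unfolding list_all_iff
    using desc_in_coalitions[OF that] compl_desc[OF that] by (auto simp: generated_game_def)
  then have "?W \<in> proper_linear_games 7"
    using lin by (auto simp: proper_linear_games_def proper_game_def)
  moreover have "?W \<notin> weighted_games 7"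
  proof
    assume "?W \<in> weighted_games 7"
    then have "\<exists>(w :: nat \<Rightarrow> real) q. \<forall>A \<subseteq> players 7. A \<in> ?W \<longleftrightarrow> q \<le> sum w A"
      unfolding weighted_games_def mem_Collect_eq by (elim conjE exE) (intro exI)
    then obtain w :: "nat \<Rightarrow> real" and q where wq: "\<forall>A \<subseteq> players 7. A \<in> ?W \<longleftrightarrow> q \<le> sum w A"
      by (elim exE)
    then have win: "list_ex (\<lambda>g. list_le g as) ?G \<longleftrightarrow> q \<le> sum w (set as)"
      if "sorted_wrt (>) as" "set as \<subseteq> players 7" for as
      using wq[rule_format, OF that(2)] that by (simp add: generated_game_def desc_set)
    have "q \<le> sum w {7, 6, 5}" "q \<le> sum w {7, 4, 3, 2, 1}"
        "sum w {7, 6, 4, 3} < q" "sum w {7, 5, 2, 1} < q"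
      using win[of "[7, 6, 5]"] win[of "[7, 4, 3, 2, 1]"]
        win[of "[7, 6, 4, 3]"] win[of "[7, 5, 2, 1]"]
      by (auto simp: players_def not_le)
    then show False by simp
  qed
  ultimately show ?thesis
    by (auto simp: weighted_games_plus_def)
qed

subsection \<open>Five players\<close>

lemma majority_5:
  "list_all (\<lambda>as. 16 < length (filter (\<lambda>bs. list_le as bs \<or> list_le (compl 5 as) bs) (coalitions 5)))
     (coalitions 5)"
  by code_simp

text \<open>If a coalition and its complement both won, so would the more than 16 coalitions above
  one of them, leaving fewer than 16 losing ones.\<close>

lemma plus_subset_proper_5: "linear_games_plus 5 \<subseteq> proper_linear_games 5"
proof
  fix W assume W: "W \<in> linear_games_plus 5"
  then have lin: "W \<in> linear_games 5" and rank: "16 \<le> game_rank 5 W"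
    by (auto simp: linear_games_plus_def)
  have False if A: "A \<subseteq> players 5" "A \<in> W" "players 5 - A \<in> W" for A
  proof -
    let ?P = "\<lambda>bs. list_le (desc A) bs \<or> list_le (compl 5 (desc A)) bs"
    have "16 < length (filter ?P (coalitions 5))"
      using majority_5 desc_in_coalitions[OF A(1)] unfolding list_all_iff by blast
    then have "16 < card {B. B \<subseteq> players 5 \<and> ?P (desc B)}"
      using card_desc_filter[of 5 ?P] by (simp only:)
    also have "\<dots> \<le> card W"
    proof (rule card_mono)
      show "finite W"
        using linear_gamesD(1)[OF lin] finite_subset by fastforce
      show "{B. B \<subseteq> players 5 \<and> ?P (desc B)} \<subseteq> W"
        using A linear_gamesD(4)[OF lin] by (auto simp: M_le_iff compl_desc[symmetric])
    qed
    finally show False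
      using rank card_winning_plus_rank[OF lin] by simp
  qed
  then show "W \<in> proper_linear_games 5"
    using lin by (auto simp: proper_linear_games_def proper_game_def)
qed

subsection \<open>Six players\<close>

text \<open>Integer weights keep the search computable. Players start at 1 and list positions at 0,
  hence the shift.\<close>

definition weight :: "int list \<Rightarrow> nat list \<Rightarrow> int" where
  "weight w as = (\<Sum>i\<leftarrow>as. w ! (i - 1))"

lemma weight_desc: "finite A \<Longrightarrow> weight w (desc A) = (\<Sum>i\<in>A. w ! (i - 1))"
  by (simp add: weight_def sum.distinct_set_conv_list[symmetric] distinct_desc set_desc
      flip: sum_list_distinct_conv_sum_set)

text \<open>The leading 0 lets a single sortedness test express both that the weights increase and
  that they are non-negative.\<close>

definition valid_weights :: "nat \<Rightarrow> int list \<Rightarrow> bool" where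
  "valid_weights n w \<longleftrightarrow> length w = n \<and> sorted (0 # w)"

lemma valid_weightsD:
  assumes "valid_weights n w"
  shows "i \<in> players n \<Longrightarrow> 0 \<le> w ! (i - 1)"
    and "i \<in> players n \<Longrightarrow> j \<in> players n \<Longrightarrow> i \<le> j \<Longrightarrow> w ! (i - 1) \<le> w ! (j - 1)"
  using assms by (auto simp: valid_weights_def players_def sorted_iff_nth_mono)

lemma weight_nonneg:
  assumes "valid_weights n w" and "set as \<subseteq> players n"
  shows "0 \<le> weight w as"
  unfolding weight_def using assms valid_weightsD(1) by (intro sum_list_nonneg) auto

text \<open>Weights are compared position by position; surplus entries of \<open>bs\<close>
  contribute non-negative amounts.\<close>

lemma weight_mono:
  assumes "valid_weights n w"
  shows "list_le as bs \<Longrightarrow> set as \<subseteq> players n \<Longrightarrow> set bs \<subseteq> players n \<Longrightarrow> weight w as \<le> weight w bs"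
proof (induction as bs rule: list_le.induct)
  case (1 bs)
  then show ?case using weight_nonneg[OF assms] by (simp add: weight_def)
next
  case (3 a as b bs)
  then show ?case
    using valid_weightsD(2)[OF assms, of a b] by (simp add: weight_def add_mono)
qed simp

text \<open>A candidate \<open>(w, l, h)\<close> records a weight vector under which the coalitions already known to be
  losing weigh at most \<open>l\<close> and those already known to be winning weigh at least \<open>h\<close>.\<close>

type_synonym candidate = "int list \<times> int \<times> int"

text \<open>Candidates without \<open>l < h\<close> leave no room for a quota and are
  dropped.\<close>

definition add_losing :: "nat list \<Rightarrow> candidate list \<Rightarrow> candidate list" where
  "add_losing a cs = filter (\<lambda>(w, l, h). l < h) (map (\<lambda>(w, l, h). (w, max l (weight w a), h)) cs)"

definition add_winning :: "nat list \<Rightarrow> candidate list \<Rightarrow> candidate list" where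
  "add_winning a cs = filter (\<lambda>(w, l, h). l < h) (map (\<lambda>(w, l, h). (w, l, min h (weight w a))) cs)"

text \<open>\<open>separable\<close> explores all proper linear games by deciding the undecided coalitions one by one:
  declaring \<open>a\<close> winning decides everything above \<open>a\<close> and below its complement, declaring it losing
  decides everything below \<open>a\<close>. A coalition below its own complement cannot be winning.
  Candidates that fit the decisions so far are kept, and every game reached must have one left.\<close>

fun separable :: "nat \<Rightarrow> nat list list \<Rightarrow> candidate list \<Rightarrow> bool" where
  "separable n [] cs = (cs \<noteq> [])"
| "separable n (a # us) cs =
     ((let b = compl n a in
        list_le a b \<or>
        separable n (filter (\<lambda>x. \<not> list_le a x \<and> \<not> list_le x b) us)
          (add_losing b (add_winning a cs))) \<and>
      separable n (filter (\<lambda>x. \<not> list_le x a) us) (add_losing a cs))"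

text \<open>The invariant of the search along the branch that follows a game \<open>v\<close>: the
  coalitions outside \<open>us\<close> are the decided ones.\<close>

definition sound_candidate :: "nat \<Rightarrow> (nat list \<Rightarrow> bool) \<Rightarrow> nat list list \<Rightarrow> candidate \<Rightarrow> bool" where
  "sound_candidate n v us = (\<lambda>(w, l, h). valid_weights n w \<and> l < h \<and>
     (\<forall>x \<in> set (coalitions n) - set us.
        (v x \<longrightarrow> h \<le> weight w x) \<and> (\<not> v x \<longrightarrow> weight w x \<le> l)))"

text \<open>The game \<open>v\<close> selects one branch of the search, and soundness of the
  candidates is preserved along it. The assumptions on \<open>v\<close> are linearity and
  properness, stated for lists.\<close>

lemma separable_sound:
  assumes "separable n us cs"
    and "\<And>x y. x \<in> set (coalitions n) \<Longrightarrow> y \<in> set (coalitions n) \<Longrightarrow> list_le x y \<Longrightarrow> v x \<Longrightarrow> v y"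
    and "\<And>x. x \<in> set (coalitions n) \<Longrightarrow> v x \<Longrightarrow> \<not> v (compl n x)"
    and "set us \<subseteq> set (coalitions n)" and "list_all (sound_candidate n v us) cs"
  shows "\<exists>w h. valid_weights n w \<and> (\<forall>x \<in> set (coalitions n). v x \<longleftrightarrow> h \<le> weight w x)"
  using assms
proof (induction n us cs rule: separable.induct)
  case (1 n cs)
  \<comment> \<open>At a leaf every coalition is decided, so by \<open>l < h\<close> the number
    \<open>h\<close> is a quota for \<open>v\<close>.\<close>
  obtain w l h where "sound_candidate n v [] (w, l, h)"
    using "1.prems"(1,5) by (cases cs) (auto simp: list_all_iff)
  then have "valid_weights n w \<and> (\<forall>x \<in> set (coalitions n). v x \<longleftrightarrow> h \<le> weight w x)"
    unfolding sound_candidate_def by fastforce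
  then show ?case by blast
next
  case (2 n a us cs)
  note mono = "2.prems"(2) and proper = "2.prems"(3)
  let ?C = "set (coalitions n)" and ?b = "compl n a"
  have a: "a \<in> ?C" and b: "?b \<in> ?C"
    using "2.prems"(4) compl_in_coalitions by auto
  have wmono: "weight w x \<le> weight w y"
    if "valid_weights n w" "x \<in> ?C" "y \<in> ?C" "list_le x y" for w x y
    using that weight_mono by (auto simp: coalitions_iff)
  have old: "valid_weights n w" "x \<in> ?C \<Longrightarrow> x \<noteq> a \<Longrightarrow> x \<notin> set us \<Longrightarrow> v x \<Longrightarrow> h \<le> weight w x"
      "x \<in> ?C \<Longrightarrow> x \<noteq> a \<Longrightarrow> x \<notin> set us \<Longrightarrow> \<not> v x \<Longrightarrow> weight w x \<le> l"
    if "(w, l, h) \<in> set cs" for w l h x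
    using that "2.prems"(5) by (fastforce simp: list_all_iff sound_candidate_def)+
  show ?case
  proof (cases "v a")
    case True
    then have nb: "\<not> v ?b"
      using a by (intro proper)
    \<comment> \<open>This excludes the shortcut disjunct, so the winning branch was really
      searched.\<close>
    then have ab: "\<not> list_le a ?b"
      using mono[OF a b] True by blast
    let ?us = "filter (\<lambda>x. \<not> list_le a x \<and> \<not> list_le x ?b) us"
    have "sound_candidate n v ?us (w, max l (weight w ?b), min h (weight w a))"
      if c: "(w, l, h) \<in> set cs" and lt: "max l (weight w ?b) < min h (weight w a)" for w l h
    proof -
      have "(v x \<longrightarrow> min h (weight w a) \<le> weight w x) \<and> (\<not> v x \<longrightarrow> weight w x \<le> max l (weight w ?b))"
        if x: "x \<in> ?C" "x \<notin> set ?us" for x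
      proof -
        \<comment> \<open>Either \<open>x\<close> was decided before or its status is forced by
          \<open>a\<close> or \<open>?b\<close>. Weights are monotone along \<open>list_le\<close>,
          so updating the bounds with \<open>a\<close> and \<open>?b\<close> alone covers all forced
          coalitions.\<close>
        consider "list_le a x" | "list_le x ?b" | "x \<noteq> a" "x \<notin> set us"
          using x by (cases "x = a") auto
        then show ?thesis
        proof cases
          case 1
          then have "v x" "weight w a \<le> weight w x"
            using mono[OF a x(1)] True wmono[OF old(1)[OF c] a x(1)] by blast+
          then show ?thesis by simp
        next
          case 2
          then have "\<not> v x" "weight w x \<le> weight w ?b"
            using mono[OF x(1) b] nb wmono[OF old(1)[OF c] x(1) b] by blast+
          then show ?thesis by simp
        next
          case 3
          then show ?thesis
            using old(2,3)[OF c x(1)] by fastforce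
        qed
      qed
      then show ?thesis
        using lt old(1)[OF c] by (simp add: sound_candidate_def)
    qed
    then have sound: "list_all (sound_candidate n v ?us) (add_losing ?b (add_winning a cs))"
      by (fastforce simp: list_all_iff add_losing_def add_winning_def)
    show ?thesis
    proof (rule "2.IH"(1)[OF refl])
      show "separable n ?us (add_losing ?b (add_winning a cs))"
        using "2.prems"(1) ab by (simp add: Let_def)
      show "set ?us \<subseteq> ?C"
        using "2.prems"(4) by auto
    qed (fact ab mono proper sound)+
  next
    case False
    let ?us = "filter (\<lambda>x. \<not> list_le x a) us"
    have "sound_candidate n v ?us (w, max l (weight w a), h)"
      if c: "(w, l, h) \<in> set cs" and lt: "max l (weight w a) < h" for w l h
    proof -
      have "(v x \<longrightarrow> h \<le> weight w x) \<and> (\<not> v x \<longrightarrow> weight w x \<le> max l (weight w a))"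
        if x: "x \<in> ?C" "x \<notin> set ?us" for x
      proof -
        \<comment> \<open>A losing \<open>a\<close> says nothing about its complement, so only
          coalitions below \<open>a\<close> are newly decided.\<close>
        consider "list_le x a" | "x \<noteq> a" "x \<notin> set us"
          using x by (cases "x = a") auto
        then show ?thesis
        proof cases
          case 1
          then have "\<not> v x" "weight w x \<le> weight w a"
            using mono[OF x(1) a] False wmono[OF old(1)[OF c] x(1) a] by blast+
          then show ?thesis by simp
        next
          case 2
          then show ?thesis
            using old(2,3)[OF c x(1)] by fastforce
        qed
      qed
      then show ?thesis
        using lt old(1)[OF c] by (simp add: sound_candidate_def)
    qed
    then have sound: "list_all (sound_candidate n v ?us) (add_losing a cs)"
      by (fastforce simp: list_all_iff add_losing_def)
    show ?thesis
    proof (rule "2.IH"(2))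
      show "separable n ?us (add_losing a cs)"
        using "2.prems"(1) by (simp add: Let_def)
      show "set ?us \<subseteq> ?C"
        using "2.prems"(4) by auto
    qed (fact mono proper sound)+
  qed
qed

text \<open>A greedy set cover of the proper linear games on six players by weights of at most 9.\<close>

definition weight_vectors_6 :: "int list list" where
  "weight_vectors_6 =
    [[0,0,1,1,1,3], [0,1,2,3,4,8], [0,1,2,4,6,8], [0,1,2,5,5,9], [0,2,2,3,3,4], [0,2,3,4,8,9],
     [0,2,4,7,8,9], [0,2,5,5,6,9], [1,1,1,1,2,4], [1,1,1,3,3,6], [1,1,1,3,4,9], [1,1,1,3,7,9],
     [1,1,1,6,6,9], [1,1,2,2,2,9], [1,1,2,3,3,7], [1,1,2,3,4,9], [1,1,2,3,6,9], [1,1,2,4,4,7],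
     [1,1,2,5,5,8], [1,1,2,5,7,9], [1,1,3,3,4,9], [1,1,3,3,5,9], [1,1,3,4,5,8], [1,1,3,4,7,9],
     [1,1,3,4,8,9], [1,1,3,4,9,9], [1,1,3,5,5,7], [1,1,3,5,5,8], [1,1,3,5,6,7], [1,1,3,5,7,9],
     [1,2,2,2,2,7], [1,2,2,2,3,6], [1,2,2,2,3,9], [1,2,2,2,5,9], [1,2,2,3,3,8], [1,2,2,3,4,9],
     [1,2,2,3,5,8], [1,2,2,3,5,9], [1,2,2,3,7,8], [1,2,2,3,7,9], [1,2,2,4,4,9], [1,2,2,4,5,7],
     [1,2,2,4,5,8], [1,2,2,4,5,9], [1,2,2,4,6,9], [1,2,2,5,5,9], [1,2,2,5,6,9], [1,2,2,6,6,9],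
     [1,2,3,3,4,9], [1,2,3,3,5,9], [1,2,3,3,6,8], [1,2,3,3,6,9], [1,2,3,3,7,8], [1,2,3,4,4,6],
     [1,2,3,4,4,9], [1,2,3,4,5,8], [1,2,3,4,5,9], [1,2,3,4,6,8], [1,2,3,4,7,8], [1,2,3,4,7,9],
     [1,2,3,5,5,9], [1,2,3,5,6,8], [1,2,3,5,7,8], [1,2,3,5,7,9], [1,2,4,4,5,7], [1,2,4,4,6,9],
     [1,2,4,4,7,9], [1,2,4,5,6,8], [1,2,4,5,6,9], [1,2,4,5,7,9], [1,2,4,6,6,9], [1,2,4,6,7,9],
     [1,2,4,7,8,9], [1,2,4,8,9,9], [1,2,5,5,8,9], [1,2,5,6,6,9], [1,3,3,4,6,8], [1,3,3,5,6,7],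
     [1,3,3,5,6,8], [1,3,3,5,8,9], [1,3,3,6,7,9], [1,3,4,5,5,7], [1,3,4,5,6,8], [1,3,4,5,7,9],
     [1,3,4,6,6,8], [1,3,4,8,8,9], [1,3,5,5,5,9], [1,4,4,6,7,9], [1,5,5,7,8,9], [1,5,6,6,9,9],
     [2,2,2,2,3,3], [2,2,2,2,3,5], [2,2,2,3,4,5], [2,2,2,3,6,7], [2,2,2,5,8,9], [2,2,3,3,4,8],
     [2,2,3,3,7,8], [2,2,3,3,7,9], [2,2,3,4,4,9], [2,2,3,4,5,6], [2,2,3,4,5,8], [2,2,3,4,5,9],
     [2,2,3,4,7,8], [2,2,3,4,8,9], [2,2,3,5,5,9], [2,2,3,5,6,8], [2,2,3,5,8,9], [2,2,3,6,6,7],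
     [2,2,4,4,5,7], [2,2,4,5,5,8], [2,2,4,5,6,7], [2,2,4,5,6,9], [2,2,4,5,8,9], [2,2,5,5,8,9],
     [2,2,6,8,8,9], [2,3,3,3,7,9], [2,3,3,4,4,6], [2,3,3,4,4,9], [2,3,3,4,5,9], [2,3,3,4,6,8],
     [2,3,3,4,7,8], [2,3,3,4,8,8], [2,3,3,5,5,9], [2,3,3,7,7,9], [2,3,4,4,4,9], [2,3,4,4,5,6],
     [2,3,4,4,5,8], [2,3,4,4,5,9], [2,3,4,4,7,8], [2,3,4,5,5,9], [2,3,4,5,6,8], [2,3,4,5,7,9],
     [2,3,4,5,8,9], [2,3,4,6,7,8], [2,3,4,6,8,9], [2,3,6,6,7,9], [2,4,4,5,6,9], [2,4,4,5,8,9],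
     [2,4,4,6,7,7], [2,4,4,6,7,9], [2,4,5,6,8,9], [2,4,5,6,9,9], [2,4,6,7,8,9], [2,5,5,6,6,9],
     [2,5,5,6,7,9], [2,5,6,6,8,9], [2,6,6,7,8,9], [3,3,3,4,4,9], [3,3,4,5,6,7], [3,3,4,8,9,9],
     [3,3,7,7,8,9], [3,4,5,5,6,9], [3,4,5,6,6,8], [3,4,6,8,8,9], [4,4,5,7,7,9], [4,4,6,6,7,9],
     [4,5,5,5,7,9], [4,5,6,7,8,9], [4,6,7,8,9,9], [4,6,8,8,8,9], [5,6,6,7,8,9]]"

text \<open>The grand coalition wins in every game, so it is decided from the start and its weight
  \<open>sum_list w\<close> is the initial upper bound; the lower bound 0 is the weight of the empty
  coalition.\<close>

lemma separable_6:
  "separable 6 (tl (coalitions 6)) (map (\<lambda>w. (w, 0, sum_list w)) weight_vectors_6)"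
  by code_simp

lemma proper_subset_weighted_plus_6: "proper_linear_games 6 \<subseteq> weighted_games_plus 6"
proof
  fix W assume W: "W \<in> proper_linear_games 6"
  then have lin: "W \<in> linear_games 6" and proper: "proper_game 6 W"
    by (auto simp: proper_linear_games_def)
  let ?v = "\<lambda>as. set as \<in> W"
  have mono: "?v y" if "x \<in> set (coalitions 6)" "y \<in> set (coalitions 6)" "list_le x y" "?v x" for x y
    using that linear_gamesD(4)[OF lin, of "set x" "set y"]
    by (simp add: coalitions_iff M_le_iff desc_set)
  have set_compl: "set (compl 6 x) = players 6 - set x" for x
    by (auto simp: compl_def players_def simp del: upt_Suc)
  have compl_losing: "\<not> ?v (compl 6 x)" if "x \<in> set (coalitions 6)" "?v x" for x
    using that proper by (auto simp: coalitions_iff proper_game_def set_compl)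
  have coal: "coalitions 6 = compl 6 [] # tl (coalitions 6)"
    by code_simp
  have "?v (compl 6 [])"
    using linear_gamesD(2)[OF lin] by (simp add: set_compl)
  \<comment> \<open>Only the grand coalition is decided initially, so these conditions are what
    soundness of the initial candidates requires.\<close>
  moreover have "list_all (\<lambda>w. valid_weights 6 w \<and> 0 < sum_list w \<and> sum_list w \<le> weight w (compl 6 []))
      weight_vectors_6"
    by code_simp
  moreover have "x = compl 6 []" if "x \<in> set (coalitions 6)" "x \<notin> set (tl (coalitions 6))" for x
    using that by (subst (asm) coal) simp
  ultimately have "list_all (sound_candidate 6 ?v (tl (coalitions 6)))
      (map (\<lambda>w. (w, 0, sum_list w)) weight_vectors_6)"
    by (fastforce simp: list_all_iff sound_candidate_def)
  moreover have "set (tl (coalitions 6)) \<subseteq> set (coalitions 6)"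
    by (subst (2) coal) auto
  ultimately obtain w h where valid: "valid_weights 6 w"
    and win: "\<And>x. x \<in> set (coalitions 6) \<Longrightarrow> ?v x \<longleftrightarrow> h \<le> weight w x"
    using separable_sound[OF separable_6, of ?v] mono compl_losing by blast
  \<comment> \<open>The empty coalition loses and weighs 0.\<close>
  have "0 < h"
    using win[of "[]"] linear_gamesD(3)[OF lin] by (simp add: coalitions_iff weight_def)
  let ?w = "\<lambda>i. real_of_int (w ! (i - 1))"
  have win': "A \<in> W \<longleftrightarrow> real_of_int h \<le> sum ?w A" if A: "A \<subseteq> players 6" for A
  proof -
    have "A \<in> W \<longleftrightarrow> h \<le> weight w (desc A)"
      using win[OF desc_in_coalitions[OF A]] finite_subset_players[OF A] by (simp add: set_desc)
    also have "\<dots> \<longleftrightarrow> real_of_int h \<le> real_of_int (\<Sum>i\<in>A. w ! (i - 1))"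
      using finite_subset_players[OF A] by (simp only: weight_desc of_int_le_iff)
    finally show ?thesis
      by (simp only: of_int_sum)
  qed
  have "W \<in> weighted_games 6"
    unfolding weighted_games_def
  proof (intro CollectI conjI exI[of _ ?w] exI[of _ "real_of_int h"])
    show "real_of_int h \<le> sum ?w (players 6)"
      using win' linear_gamesD(2)[OF lin] by blast
    show "\<forall>A \<subseteq> players 6. A \<in> W \<longleftrightarrow> real_of_int h \<le> sum ?w A"
      using win' by blast
    show "W \<in> linear_games 6" "0 < real_of_int h"
      using lin \<open>0 < h\<close> by simp_all
    show "\<forall>i \<in> players 6. 0 \<le> ?w i"
      using valid_weightsD(1)[OF valid] by (intro ballI) (simp only: of_int_0_le_iff)
    show "\<forall>i \<in> players 6. \<forall>j \<in> players 6. i \<le> j \<longrightarrow> ?w i \<le> ?w j"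
      using valid_weightsD(2)[OF valid] by (intro ballI impI) (simp only: of_int_le_iff)
  qed
  then show "W \<in> weighted_games_plus 6"
    using W proper_subset_plus[of 6] by (auto simp: weighted_games_plus_def linear_games_plus_def)
qed

section \<open>Passage from the small cases to all \<open>n\<close>\<close>

theorem theorem3p8:
  fixes n :: nat
  assumes "n \<ge> 1"
  shows "weighted_games_plus n \<subseteq> proper_linear_games n
       \<and> proper_linear_games n \<subseteq> linear_games_plus n
       \<and> (weighted_games_plus n \<subset> proper_linear_games n \<longleftrightarrow> n \<ge> 7)
       \<and> (proper_linear_games n \<subset> linear_games_plus n \<longleftrightarrow> n \<ge> 6)"
proof -
  \<comment> \<open>Downward induction from \<open>k\<close> to \<open>m\<close>, staying at or
    above 1 because the descent lemmas assume it.\<close>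
  have down: "P m" if "\<forall>i \<ge> 1. P (Suc i) \<longrightarrow> P i" "1 \<le> m" "m \<le> k" "P k" for P and m k :: nat
    using that(3,4)
  proof (rule inc_induct)
    show "P i" if "m \<le> i" "P (Suc i)" for i
      using \<open>\<forall>i \<ge> 1. P (Suc i) \<longrightarrow> P i\<close> \<open>1 \<le> m\<close> that by (meson le_trans)
  qed
  let ?P = "\<lambda>m. weighted_games_plus m = proper_linear_games m"
  let ?Q = "\<lambda>m. proper_linear_games m = linear_games_plus m"
  have "\<forall>i \<ge> 1. ?P (Suc i) \<longrightarrow> ?P i"
    using weighted_plus_eq_proper_down by blast
  note down_P = down[of ?P, OF this]
  have "\<forall>i \<ge> 1. ?Q (Suc i) \<longrightarrow> ?Q i"
    using proper_eq_plus_down by blast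
  note down_Q = down[of ?Q, OF this]
  have "?P 6"
    using weighted_plus_subset_proper[of 6] proper_subset_weighted_plus_6 by auto
  \<comment> \<open>Equality at 6 descends to every smaller \<open>n\<close>, while equality at some
    \<open>n \<ge> 7\<close> would descend to 7, where it fails.\<close>
  then have "?P n \<longleftrightarrow> \<not> n \<ge> 7"
    using down_P[of n 6] down_P[of 7 n] assms weighted_plus_ne_proper_7 by linarith
  moreover have "?Q 5"
    using proper_subset_plus[of 5] plus_subset_proper_5 by auto
  then have "?Q n \<longleftrightarrow> \<not> n \<ge> 6"
    using down_Q[of n 5] down_Q[of 6 n] assms proper_ne_plus_6 by linarith
  ultimately show ?thesis
    using weighted_plus_subset_proper[OF assms] proper_subset_plus[OF assms]
    by (auto simp: psubset_eq)
qed

end
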